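(* Let $n,k$ be positive integers and let $(Q,\cdot)$ be a $k$-translatable quasigroup of order $n$, with $Q=\{1,2,\ldots,n\}$. Then the following statements are equivalent: (a) $(Q,\cdot)$ is quadratical; (b) $(Q,\cdot)$ is right distributive and $[k^2]_n=[-1]_n$; (c) $(Q,\cdot)$ is right distributive and alterable; (d) $(Q,\cdot)$ is left distributive and alterable.
   Context: For an integer $m$, $[m]_n$ denotes the residue class of $m$ modulo $n$, represented in $\{1,\ldots,n\}$ (so $0=n$); $[u]_n=[v]_n$ means $u\equiv v\pmod n$. A groupoid is a set with a binary operation. A groupoid on $Q=\{1,\ldots,n\}$ (with natural ordering) is $k$-translatable if $i\cdot j=[i+1]_n\cdot[j+k]_n$ for all $i,j\in Q$. A quasigroup is a groupoid in which $ax=b$ and $xa=b$ are uniquely solvable for $x$. A quasigroup is quadratical if it satisfies $(x\cdot y)\cdot x=(z\cdot x)\cdot(y\cdot z)$; left distributive if $x\cdot(y\cdot z)=(x\cdot y)\cdot(x\cdot z)$; right distributive if $(x\cdot y)\cdot z=(x\cdot z)\cdot(y\cdot z)$; alterable if for all $x,y,z,w$: $x\cdot y=z\cdot w$ if and only if $y\cdot z=w\cdot x$. *)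

theory Defs
  imports Main
begin

(* The residue class [m]_n, represented in {1..n}; multiples of n are represented by n. *)
definition residue :: "int \<Rightarrow> int \<Rightarrow> int" where
  "residue n m = (if m mod n = 0 then n else m mod n)"

(* A groupoid on Q is a total function f whose values outside Q are irrelevant;
   all properties below quantify over elements of Q only. *)
definition groupoid :: "'a set \<Rightarrow> ('a \<Rightarrow> 'a \<Rightarrow> 'a) \<Rightarrow> bool" where
  "groupoid Q f \<longleftrightarrow> (\<forall>x\<in>Q. \<forall>y\<in>Q. f x y \<in> Q)"

definition quasigroup :: "'a set \<Rightarrow> ('a \<Rightarrow> 'a \<Rightarrow> 'a) \<Rightarrow> bool" where
  "quasigroup Q f \<longleftrightarrow> groupoid Q f \<and>
     (\<forall>a\<in>Q. \<forall>b\<in>Q. (\<exists>!x. x \<in> Q \<and> f a x = b) \<and> (\<exists>!x. x \<in> Q \<and> f x a = b))"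

(* Refers to the carrier {1..n} in its natural ordering. *)
definition translatable :: "int \<Rightarrow> int \<Rightarrow> (int \<Rightarrow> int \<Rightarrow> int) \<Rightarrow> bool" where
  "translatable n k f \<longleftrightarrow>
     (\<forall>i\<in>{1..n}. \<forall>j\<in>{1..n}. f i j = f (residue n (i + 1)) (residue n (j + k)))"

definition quadratical :: "'a set \<Rightarrow> ('a \<Rightarrow> 'a \<Rightarrow> 'a) \<Rightarrow> bool" where
  "quadratical Q f \<longleftrightarrow> quasigroup Q f \<and>
     (\<forall>x\<in>Q. \<forall>y\<in>Q. \<forall>z\<in>Q. f (f x y) x = f (f z x) (f y z))"

definition left_distributive :: "'a set \<Rightarrow> ('a \<Rightarrow> 'a \<Rightarrow> 'a) \<Rightarrow> bool" where
  "left_distributive Q f \<longleftrightarrow>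
     (\<forall>x\<in>Q. \<forall>y\<in>Q. \<forall>z\<in>Q. f x (f y z) = f (f x y) (f x z))"

definition right_distributive :: "'a set \<Rightarrow> ('a \<Rightarrow> 'a \<Rightarrow> 'a) \<Rightarrow> bool" where
  "right_distributive Q f \<longleftrightarrow>
     (\<forall>x\<in>Q. \<forall>y\<in>Q. \<forall>z\<in>Q. f (f x y) z = f (f x z) (f y z))"

definition alterable :: "'a set \<Rightarrow> ('a \<Rightarrow> 'a \<Rightarrow> 'a) \<Rightarrow> bool" where
  "alterable Q f \<longleftrightarrow>
     (\<forall>x\<in>Q. \<forall>y\<in>Q. \<forall>z\<in>Q. \<forall>w\<in>Q. f x y = f z w \<longleftrightarrow> f y z = f w x)"

end

theory Submission
  imports Defs
begin

text \<open>
  Translatability says that \<open>f i j = g (j - k * i)\<close> modulo \<open>n\<close>, where \<open>g\<close> permutes the residue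
  classes. Alterability is then equivalent to \<open>k\<^sup>2 \<equiv> -1\<close>. Each of the three identities
  (quadratical, left and right distributive) implies idempotency by cancellation, and idempotency
  means \<open>g ((1 - k) * i) = i\<close>, so that \<open>1 - k\<close> is invertible and
  \<open>f i j \<equiv> (j - k * i) / (1 - k)\<close>. Such an operation is medial, hence distributive on both sides,
  and it is quadratical exactly when \<open>k\<^sup>2 \<equiv> -1\<close>.
\<close>

definition idempotent :: "'a set \<Rightarrow> ('a \<Rightarrow> 'a \<Rightarrow> 'a) \<Rightarrow> bool" where
  "idempotent Q f \<longleftrightarrow> (\<forall>x\<in>Q. f x x = x)"

section \<open>Cancellation and idempotency in quasigroups\<close>

lemma quasigroup_closed: "quasigroup Q f \<Longrightarrow> x \<in> Q \<Longrightarrow> y \<in> Q \<Longrightarrow> f x y \<in> Q"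
  by (simp add: quasigroup_def groupoid_def)

lemma quasigroup_left_cancel:
  assumes "quasigroup Q f" "a \<in> Q" "x \<in> Q" "y \<in> Q"
  shows "f a x = f a y \<longleftrightarrow> x = y"
proof -
  have "\<exists>!u. u \<in> Q \<and> f a u = f a x"
    using assms quasigroup_closed[OF assms(1-3)] unfolding quasigroup_def by blast
  then show ?thesis
    using assms by metis
qed

lemma quasigroup_right_cancel:
  assumes "quasigroup Q f" "a \<in> Q" "x \<in> Q" "y \<in> Q"
  shows "f x a = f y a \<longleftrightarrow> x = y"
proof -
  have "\<exists>!u. u \<in> Q \<and> f u a = f x a"
    using assms quasigroup_closed[OF assms(1,3,2)] unfolding quasigroup_def by blast
  then show ?thesis
    using assms by metis
qed

text \<open>Setting \<open>y = z = x\<close> yields \<open>f (f x x) x = f (f x x) (f x x)\<close>,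
  and \<open>f x x\<close> cancels on the left. The distributive laws are treated by the same
  substitution, with \<open>x\<close> cancelled on the right in the left distributive case.\<close>

lemma quadratical_imp_idempotent:
  assumes "quadratical Q f"
  shows "idempotent Q f"
  unfolding idempotent_def
proof
  fix x assume x: "x \<in> Q"
  have q: "quasigroup Q f" and "f (f x x) x = f (f x x) (f x x)"
    using assms x by (auto simp: quadratical_def)
  then show "f x x = x"
    using quasigroup_left_cancel[OF q] quasigroup_closed[OF q] x by metis
qed

lemma right_distributive_imp_idempotent:
  assumes q: "quasigroup Q f" and "right_distributive Q f"
  shows "idempotent Q f"
  unfolding idempotent_def
proof
  fix x assume x: "x \<in> Q"
  have "f (f x x) x = f (f x x) (f x x)"
    using assms x by (auto simp: right_distributive_def)
  then show "f x x = x"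
    using quasigroup_left_cancel[OF q] quasigroup_closed[OF q] x by metis
qed

lemma left_distributive_imp_idempotent:
  assumes q: "quasigroup Q f" and "left_distributive Q f"
  shows "idempotent Q f"
  unfolding idempotent_def
proof
  fix x assume x: "x \<in> Q"
  have "f x (f x x) = f (f x x) (f x x)"
    using assms x by (auto simp: left_distributive_def)
  then show "f x x = x"
    using quasigroup_right_cancel[OF q] quasigroup_closed[OF q] x by metis
qed

section \<open>Residue classes and translation\<close>

lemma residue_in: "n > 0 \<Longrightarrow> residue n m \<in> {1..n}"
  using pos_mod_bound[of n m] pos_mod_sign[of n m]
  by (simp add: residue_def del: pos_mod_bound pos_mod_sign)

lemma residue_of_in: "i \<in> {1..n} \<Longrightarrow> residue n i = i"
  by (cases "i = n") (auto simp: residue_def)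

lemma residue_mod: "residue n m mod n = m mod n"
  by (simp add: residue_def)

lemma dvd_residue_diff: "n dvd residue n m - m"
  by (simp add: mod_eq_dvd_iff[symmetric] residue_mod)

lemma residue_eq_iff: "residue n a = residue n b \<longleftrightarrow> n dvd a - b"
proof -
  have "residue n a = residue n b \<longleftrightarrow> a mod n = b mod n"
    using residue_mod[of n a] residue_mod[of n b] by (auto simp: residue_def[of n])
  then show ?thesis
    by (simp only: mod_eq_dvd_iff)
qed

lemma residue_residue_add: "residue n (residue n a + b) = residue n (a + b)"
  by (simp add: residue_eq_iff dvd_residue_diff)

lemma translatable_shift:
  assumes "n > 0" "translatable n k f"
  shows "f (residue n i) (residue n j) = f (residue n (i + int m)) (residue n (j + k * int m))"
proof (induction m)
  case (Suc m)
  have "f (residue n (i + int m)) (residue n (j + k * int m))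
      = f (residue n (i + int m + 1)) (residue n (j + k * int m + k))"
    using assms(2) residue_in[OF assms(1)] unfolding translatable_def by (metis residue_residue_add)
  then show ?case
    using Suc by (simp add: algebra_simps)
qed simp

text \<open>Starting from row \<open>n\<close>, which represents row 0, and column
  \<open>j - k * i\<close>, exactly \<open>i\<close> shifts lead to the entry at \<open>i\<close>,
  \<open>j\<close>. Row \<open>n\<close> is thus the map \<open>g\<close> of the overview.\<close>

lemma translatable_eq:
  assumes "n > 0" "translatable n k f" "i \<in> {1..n}" "j \<in> {1..n}"
  shows "f i j = f n (residue n (j - k * i))"
  using translatable_shift[OF assms(1,2), of 0 "j - k * i" "nat i"] assms residue_of_in
  by (simp add: residue_def[of n 0])

context
  fixes n k :: int and f :: "int \<Rightarrow> int \<Rightarrow> int"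
  assumes n_pos: "n > 0"
    and quasi: "quasigroup {1..n} f"
    and transl: "translatable n k f"
begin

text \<open>Row \<open>n\<close> is injective by left cancellation, so only its arguments need
  comparing. This turns equations in the quasigroup into divisibility by \<open>n\<close>.\<close>

lemma translatable_product_eq_iff:
  assumes "x \<in> {1..n}" "y \<in> {1..n}" "z \<in> {1..n}" "w \<in> {1..n}"
  shows "f x y = f z w \<longleftrightarrow> n dvd (y - k * x) - (w - k * z)"
proof -
  have "n \<in> {1..n}"
    using n_pos by simp
  then have "f x y = f z w \<longleftrightarrow> residue n (y - k * x) = residue n (w - k * z)"
    unfolding translatable_eq[OF n_pos transl assms(1,2)] translatable_eq[OF n_pos transl assms(3,4)]
    by (intro quasigroup_left_cancel[OF quasi] residue_in n_pos)
  then show ?thesis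
    by (simp only: residue_eq_iff)
qed

lemma alterable_iff: "alterable {1..n} f \<longleftrightarrow> n dvd k\<^sup>2 + 1"
proof
  assume alt: "alterable {1..n} f"
  \<comment> \<open>As \<open>y\<close> is congruent to \<open>k\<close> and \<open>n\<close> to 0,
    both \<open>f 1 y\<close> and \<open>f n n\<close> are the entry of row \<open>n\<close> at
    class 0. Alterability then gives \<open>f y n = f n 1\<close>, which reads \<open>-k * k\<close>
    congruent to 1.\<close>
  define y where "y = residue n k"
  have y: "y \<in> {1..n}" "n dvd y - k"
    using residue_in[OF n_pos] dvd_residue_diff by (auto simp: y_def)
  have mem: "1 \<in> {1..n}" "n \<in> {1..n}"
    using n_pos by auto
  have "n dvd (y - k * 1) - (n - k * n)"
    using y(2) by simp
  then have "f 1 y = f n n"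
    using translatable_product_eq_iff mem y by blast
  then have "f y n = f n 1"
    using alt mem y(1) unfolding alterable_def by blast
  then have "n dvd (n - k * y) - (1 - k * n)"
    using translatable_product_eq_iff mem y by blast
  moreover have "k\<^sup>2 + 1 = n + k * n - k * (y - k) - ((n - k * y) - (1 - k * n))"
    by (simp add: algebra_simps power2_eq_square)
  moreover have "n dvd n + k * n - k * (y - k)"
    by (rule dvd_diff[OF _ dvd_mult[OF y(2)]]) simp
  ultimately show "n dvd k\<^sup>2 + 1"
    by (metis dvd_diff)
next
  assume k: "n dvd k\<^sup>2 + 1"
  show "alterable {1..n} f"
    unfolding alterable_def
  proof (intro ballI)
    fix x y z w
    assume mem: "x \<in> {1..n}" "y \<in> {1..n}" "z \<in> {1..n}" "w \<in> {1..n}"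
    \<comment> \<open>Modulo \<open>k\<^sup>2 + 1\<close>, the factors \<open>-k\<close> and
      \<open>k\<close> are mutually inverse: they carry \<open>?A\<close> to \<open>?B\<close> and
      back.\<close>
    have "n dvd (y - k * x) - (w - k * z) \<longleftrightarrow> n dvd (z - k * y) - (x - k * w)" (is "n dvd ?A \<longleftrightarrow> n dvd ?B")
    proof
      assume "n dvd ?A"
      then have "n dvd - k * ?A - (k\<^sup>2 + 1) * (x - z)"
        using k by (intro dvd_diff[OF dvd_mult dvd_mult2])
      also have "\<dots> = ?B"
        by (simp add: algebra_simps power2_eq_square)
      finally show "n dvd ?B" .
    next
      assume "n dvd ?B"
      then have "n dvd k * ?B + (k\<^sup>2 + 1) * (y - w)"
        using k by (intro dvd_add[OF dvd_mult dvd_mult2])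
      also have "\<dots> = ?A"
        by (simp add: algebra_simps power2_eq_square)
      finally show "n dvd ?A" .
    qed
    then show "f x y = f z w \<longleftrightarrow> f y z = f w x"
      using translatable_product_eq_iff mem by blast
  qed
qed

section \<open>Idempotent translatable quasigroups\<close>

context
  assumes idem: "idempotent {1..n} f"
begin

lemma idempotent_product:
  assumes "x \<in> {1..n}" "y \<in> {1..n}"
  shows "n dvd (1 - k) * f x y - (y - k * x)"
proof -
  have h: "f x y \<in> {1..n}"
    using quasigroup_closed[OF quasi] assms by blast
  then have "f (f x y) (f x y) = f x y"
    using idem by (simp add: idempotent_def)
  then show ?thesis
    using translatable_product_eq_iff[OF h h assms] by (simp add: algebra_simps)
qed

text \<open>Multiplying by \<open>1 - k\<close>, which is cancellable modulo \<open>n\<close>,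
  clears the denominators of the inner products.\<close>

lemma idempotent_product_of_products_eq_iff:
  assumes "x \<in> {1..n}" "y \<in> {1..n}" "z \<in> {1..n}" "w \<in> {1..n}"
    and "x' \<in> {1..n}" "y' \<in> {1..n}" "z' \<in> {1..n}" "w' \<in> {1..n}"
  shows "f (f x y) (f z w) = f (f x' y') (f z' w') \<longleftrightarrow>
    n dvd (w - k * z - k * (y - k * x)) - (w' - k * z' - k * (y' - k * x'))"
    (is "_ \<longleftrightarrow> n dvd ?D")
proof -
  let ?E = "\<lambda>x y. (1 - k) * f x y - (y - k * x)"
  let ?d = "(f z w - k * f x y) - (f z' w' - k * f x' y')"
  \<comment> \<open>If \<open>(1 - k) * d\<close> vanishes modulo \<open>n\<close>, then the residue
    of \<open>d\<close> and \<open>n\<close> have the same square, and idempotency makes them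
    equal.\<close>
  have unit: "n dvd d" if "n dvd (1 - k) * d" for d
  proof -
    have r: "residue n d \<in> {1..n}" "n \<in> {1..n}"
      using residue_in n_pos by auto
    have "n dvd (1 - k) * (residue n d - d) + (1 - k) * d - (1 - k) * n"
      by (rule dvd_diff[OF dvd_add[OF dvd_mult[OF dvd_residue_diff] that]]) simp
    also have "\<dots> = (residue n d - k * residue n d) - (n - k * n)"
      by (simp add: algebra_simps)
    finally have "f (residue n d) (residue n d) = f n n"
      using translatable_product_eq_iff[OF r(1,1,2,2)] by blast
    then have "residue n d = n"
      using idem r by (simp add: idempotent_def)
    then show ?thesis
      by (metis dvd_residue_diff dvd_diff_right_iff dvd_refl)
  qed
  have E: "n dvd ?E z w - k * ?E x y - (?E z' w' - k * ?E x' y')"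
    by (intro dvd_diff[OF dvd_diff[OF _ dvd_mult] dvd_diff[OF _ dvd_mult]] idempotent_product assms)
  \<comment> \<open>The terms \<open>?E\<close> are the errors of replacing
    \<open>(1 - k) * f x y\<close> by \<open>y - k * x\<close>; they are multiples of
    \<open>n\<close>.\<close>
  have eq: "(1 - k) * ?d = ?D + (?E z w - k * ?E x y - (?E z' w' - k * ?E x' y'))"
    by (simp add: algebra_simps)
  have "f (f x y) (f z w) = f (f x' y') (f z' w') \<longleftrightarrow> n dvd ?d"
    by (intro translatable_product_eq_iff quasigroup_closed[OF quasi] assms)
  also have "\<dots> \<longleftrightarrow> n dvd (1 - k) * ?d"
    using unit dvd_mult by blast
  also have "\<dots> \<longleftrightarrow> n dvd ?D"
    unfolding eq by (rule dvd_add_left_iff[OF E])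
  finally show ?thesis .
qed

text \<open>The expression \<open>w - k * z - k * (y - k * x)\<close> is symmetric in
  \<open>y\<close> and \<open>z\<close>.\<close>

lemma idempotent_medial:
  assumes "x \<in> {1..n}" "y \<in> {1..n}" "z \<in> {1..n}" "w \<in> {1..n}"
  shows "f (f x y) (f z w) = f (f x z) (f y w)"
  using idempotent_product_of_products_eq_iff[OF assms assms(1,3,2,4)] by (simp add: algebra_simps)

lemma idempotent_imp_right_distributive: "right_distributive {1..n} f"
  unfolding right_distributive_def
proof (intro ballI)
  fix x y z assume "x \<in> {1..n}" "y \<in> {1..n}" "z \<in> {1..n}"
  then show "f (f x y) z = f (f x z) (f y z)"
    using idem idempotent_medial[of x y z z] by (simp add: idempotent_def)
qed

lemma idempotent_imp_left_distributive: "left_distributive {1..n} f"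
  unfolding left_distributive_def
proof (intro ballI)
  fix x y z assume "x \<in> {1..n}" "y \<in> {1..n}" "z \<in> {1..n}"
  then show "f x (f y z) = f (f x y) (f x z)"
    using idem idempotent_medial[of x x y z] by (simp add: idempotent_def)
qed

lemma idempotent_imp_quadratical_iff: "quadratical {1..n} f \<longleftrightarrow> n dvd k\<^sup>2 + 1"
proof -
  have eq: "f (f x y) x = f (f z x) (f y z) \<longleftrightarrow> n dvd (k\<^sup>2 + 1) * (x - z)"
    if "x \<in> {1..n}" "y \<in> {1..n}" "z \<in> {1..n}" for x y z
  proof -
    \<comment> \<open>Writing the last \<open>x\<close> as \<open>f x x\<close> makes both sides
      products of products.\<close>
    have "f (f x y) x = f (f x y) (f x x)"
      using idem that by (simp add: idempotent_def)
    moreover have "(x - k * x - k * (y - k * x)) - (z - k * y - k * (x - k * z)) = (k\<^sup>2 + 1) * (x - z)"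
      by (simp add: algebra_simps power2_eq_square)
    ultimately show ?thesis
      using idempotent_product_of_products_eq_iff[of x y x x z x y z] that by simp
  qed
  show ?thesis
  proof
    assume "quadratical {1..n} f"
    \<comment> \<open>The choice \<open>x = 1\<close>, \<open>z = n\<close> makes
      \<open>x - z\<close> congruent to 1.\<close>
    then have "n dvd (k\<^sup>2 + 1) * (1 - n)"
      using eq[of 1 1 n] n_pos by (simp add: quadratical_def)
    then show "n dvd k\<^sup>2 + 1"
      by (simp add: algebra_simps dvd_add_left_iff dvd_diff_left_iff)
  next
    assume "n dvd k\<^sup>2 + 1"
    then show "quadratical {1..n} f"
      using quasi eq unfolding quadratical_def by (meson dvd_mult2)
  qed
qed

end

lemma quadratical_iff: "quadratical {1..n} f \<longleftrightarrow> idempotent {1..n} f \<and> n dvd k\<^sup>2 + 1"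
  using quadratical_imp_idempotent idempotent_imp_quadratical_iff by blast

lemma right_distributive_iff: "right_distributive {1..n} f \<longleftrightarrow> idempotent {1..n} f"
  using right_distributive_imp_idempotent[OF quasi] idempotent_imp_right_distributive by blast

lemma left_distributive_iff: "left_distributive {1..n} f \<longleftrightarrow> idempotent {1..n} f"
  using left_distributive_imp_idempotent[OF quasi] idempotent_imp_left_distributive by blast

end

theorem theorem3p6:
  fixes n k :: int and Q :: "int set" and f :: "int \<Rightarrow> int \<Rightarrow> int"
  assumes "n > 0" and "k > 0"
    and "Q = {1..n}"
    and "quasigroup Q f"
    and "translatable n k f"
  shows "(quadratical Q f \<longleftrightarrow> (right_distributive Q f \<and> residue n (k^2) = residue n (-1))) \<and>
         (quadratical Q f \<longleftrightarrow> (right_distributive Q f \<and> alterable Q f)) \<and>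
         (quadratical Q f \<longleftrightarrow> (left_distributive Q f \<and> alterable Q f))"
proof -
  note ctxt = \<open>n > 0\<close> \<open>quasigroup Q f\<close>[unfolded \<open>Q = {1..n}\<close>] \<open>translatable n k f\<close>
  \<comment> \<open>Each statement becomes idempotency together with
    \<open>n dvd k\<^sup>2 + 1\<close>; the residue condition turns into
    \<open>n dvd k\<^sup>2 - (-1)\<close>.\<close>
  show ?thesis
    unfolding \<open>Q = {1..n}\<close> quadratical_iff[OF ctxt] right_distributive_iff[OF ctxt]
      left_distributive_iff[OF ctxt] alterable_iff[OF ctxt] residue_eq_iff
    by simp
qed

end
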